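(* Let $d\ge 2$ be an integer, let $\omega$ be a $(d-1,1)$-weight vector, let $x={}^t(\xi_1,\dots,\xi_{d-1})\in M_{d-1,1}$, and let $k\in\{1,\dots,d-1\}$. Assume there exists a $k$-element subset $\{n_1,\dots,n_k\}\subset\{1,\dots,d-1\}$ such that $1,\xi_{n_1},\dots,\xi_{n_k}$ are linearly independent over $\mathbb{Q}$. Then $\{x\}$ is not contained in any proper rational weakly constraining $k$-pencil, and $\boldsymbol{L}^{\omega}(\Lambda_x,\cdot)$ is connected at $k$. In particular, if $1,\xi_1,\dots,\xi_{d-1}$ are linearly independent over $\mathbb{Q}$, then $\boldsymbol{L}^{\omega}(\Lambda_x,\cdot)$ is connected at every $1\le k\le d-1$.
   Context: Let $m=d-1$ and $n=1$. $M_{m,n}$ denotes the space of real $m\times n$ matrices, and ${}^t$ denotes transpose. Vectors of $\mathbb{R}^d$ are column vectors; $e_1,\dots,e_d$ is the standard basis. A vector $\omega=(\omega_1,\dots,\omega_d)\in\mathbb{R}^d$ is an $(m,n)$-weight vector if $\omega_1\ge\cdots\ge\omega_m>0$, $\omega_{m+1}\ge\cdots\ge\omega_d>0$ and $\sum_{i=1}^m\omega_i=\sum_{j=m+1}^d\omega_j=1$. For $t\in\mathbb{R}$ put $a^{\omega}_t=\mathrm{diag}(e^{\omega_1 t},\dots,e^{\omega_m t},e^{-\omega_{m+1}t},\dots,e^{-\omega_d t})$. For $x\in M_{m,n}$ put $u(x)=\begin{pmatrix}\mathbb{I}_m & x\\ 0&\mathbb{I}_n\end{pmatrix}$, $\Lambda_x=u(x)\mathbb{Z}^d$,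 and let $\tilde{x}=(\mathbb{I}_m\mid x)\in M_{m,d}$ be the first $m$ rows of $u(x)$, regarded as a linear map $\mathbb{R}^d\to\mathbb{R}^m\cong\langle e_1,\dots,e_m\rangle$. A unimodular lattice is a lattice in $\mathbb{R}^d$ of covolume $1$. Let $\mathcal{C}$ be the closed unit cube of $\mathbb{R}^d$ centered at $0$ (its side length is immaterial below: rescaling $\mathcal{C}$ adds the same constant to all $L_i^\omega$). For a unimodular lattice $\Lambda$, $t\ge 0$ and $1\le i\le d$, $\lambda_i(a^{\omega}_t\Lambda)$ is the least $\lambda>0$ such that $\lambda\mathcal{C}$ contains $i$ linearly independent vectors of $a^{\omega}_t\Lambda$. Set $L^{\omega}_i(\Lambda,t)=\log\lambda_i(a^{\omega}_t\Lambda)$ and $\boldsymbol{L}^{\omega}(\Lambda,t)=(L^{\omega}_1(\Lambda,t),\dots,L^{\omega}_d(\Lambda,t))$. $\boldsymbol{L}^{\omega}(\Lambda,\cdot)$ is connected at $k$ if the set $\{t\ge 0: L^{\omega}_k(\Lambda,t)=L^{\omega}_{k+1}(\Lambda,t)\}$ is unbounded above. For linear subspaces $W\subset\mathbb{R}^d$ and $W'\subset\langle e_1,\dots,e_m\rangle$ set $I(W)=\{i\in\{m+1,\dots,d\}:\dim(W\cap\langle e_1,\dots,e_i\rangle)>\dim(W\cap\langle e_1,\dots,e_{i-1}\rangle)\}$, $J(W')=\{j\in\{1,\dots,m\}:\dim(W'\cap\langle e_{j+1},\dots,e_m\rangle)<\dim(W'\cap\langle e_j,\dots,e_m\rangle)\}$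 (with $\langle e_{j+1},\dots,e_m\rangle=0$ if $j=m$), and $\psi(W)=\sum_{i\in I(W)}\omega_i$, $\phi(W')=\sum_{j\in J(W')}\omega_j$ (empty sums are $0$). For $a,b\in\mathbb{R}$ and a $k$-dimensional subspace $W\subset\mathbb{R}^d$, the $k$-pencil $\mathcal{P}^{\omega}_{W,a,b}$ is $\{x\in M_{m,n}:\psi(\ker\tilde{x}\cap W)\ge a\text{ and }\phi(\tilde{x}W)\le b\}$. It is rational if $W$ has a basis in $\mathbb{Q}^d$, weakly constraining if $b\le a$, and proper if $\mathcal{P}^{\omega}_{W,a,b}\ne M_{m,n}$. *)

theory Defs
  imports "HOL-Analysis.Analysis"
begin

text \<open>
  Rows of an \<open>m \<times> n\<close> matrix are indexed by a finite linearly ordered type \<open>'m\<close> with \<open>m\<close>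
  elements, columns by such a type \<open>'n\<close>. The coordinates \<open>1, \<dots>, d\<close> of \<open>\<real>\<^sup>d\<close> are indexed by
  \<open>'m + 'n\<close>: \<open>Inl\<close> gives \<open>1, \<dots>, m\<close> in the order of \<open>'m\<close>, and \<open>Inr\<close> gives \<open>m + 1, \<dots>, d\<close> in the
  order of \<open>'n\<close>. A subspace of \<open>\<langle>e\<^sub>1, \<dots>, e\<^sub>m\<rangle>\<close> is regarded as a subspace of \<open>\<real>\<^sup>m\<close>.
\<close>

definition weight_vector :: "real ^ ('m::{finite,linorder} + 'n::{finite,linorder}) \<Rightarrow> bool" where
  "weight_vector \<omega> \<longleftrightarrow>
     (\<forall>i j. i \<le> j \<longrightarrow> \<omega> $ Inl j \<le> \<omega> $ Inl i) \<and> (\<forall>i. 0 < \<omega> $ Inl i) \<and>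
     (\<forall>i j. i \<le> j \<longrightarrow> \<omega> $ Inr j \<le> \<omega> $ Inr i) \<and> (\<forall>j. 0 < \<omega> $ Inr j) \<and>
     (\<Sum>i\<in>UNIV. \<omega> $ Inl i) = 1 \<and> (\<Sum>j\<in>UNIV. \<omega> $ Inr j) = 1"

definition diag_flow ::
  "real ^ ('m::finite + 'n::finite) \<Rightarrow> real \<Rightarrow> real ^ ('m + 'n) ^ ('m + 'n)" where
  "diag_flow \<omega> t = (\<chi> i j. if i = j
     then (case i of Inl _ \<Rightarrow> exp (\<omega> $ i * t) | Inr _ \<Rightarrow> exp (- \<omega> $ i * t)) else 0)"

definition unip :: "real ^ 'n::finite ^ 'm::finite \<Rightarrow> real ^ ('m + 'n) ^ ('m + 'n)" where
  "unip x = (\<chi> i j. case (i, j) of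
     (Inl k, Inl l) \<Rightarrow> if k = l then 1 else 0
   | (Inl k, Inr l) \<Rightarrow> x $ k $ l
   | (Inr k, Inl l) \<Rightarrow> 0
   | (Inr k, Inr l) \<Rightarrow> if k = l then 1 else 0)"

definition top_rows :: "real ^ 'n::finite ^ 'm::finite \<Rightarrow> real ^ ('m + 'n) ^ 'm" where
  "top_rows x = (\<chi> i. unip x $ Inl i)"

definition int_vectors :: "(real ^ 'a::finite) set" where
  "int_vectors = {v. \<forall>i. v $ i \<in> \<int>}"

definition lattice_of :: "real ^ 'n::finite ^ 'm::finite \<Rightarrow> (real ^ ('m + 'n)) set" where
  "lattice_of x = (*v) (unip x) ` int_vectors"

text \<open>The closed cube of side length 1 centered at 0.\<close>

definition unit_cube :: "(real ^ 'a::finite) set" where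
  "unit_cube = {v. \<forall>i. \<bar>v $ i\<bar> \<le> 1 / 2}"

text \<open>
  The minimum exists whenever \<open>\<Lambda>\<close> is a lattice and \<open>1 \<le> i \<le> d\<close>.
\<close>

definition succ_min :: "nat \<Rightarrow> (real ^ 'a::finite) set \<Rightarrow> real" where
  "succ_min i \<Lambda> = (LEAST r. 0 < r \<and>
     (\<exists>S \<subseteq> (*\<^sub>R) r ` unit_cube \<inter> \<Lambda>. independent S \<and> card S = i))"

definition log_min ::
  "real ^ ('m::finite + 'n::finite) \<Rightarrow> (real ^ ('m + 'n)) set \<Rightarrow> nat \<Rightarrow> real \<Rightarrow> real" where
  "log_min \<omega> \<Lambda> i t = ln (succ_min i ((*v) (diag_flow \<omega> t) ` \<Lambda>))"

definition connected_at ::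
  "real ^ ('m::finite + 'n::finite) \<Rightarrow> (real ^ ('m + 'n)) set \<Rightarrow> nat \<Rightarrow> bool" where
  "connected_at \<omega> \<Lambda> k \<longleftrightarrow>
     \<not> bdd_above {t. 0 \<le> t \<and> log_min \<omega> \<Lambda> k t = log_min \<omega> \<Lambda> (k + 1) t}"

definition jumps_I ::
  "(real ^ ('m::{finite,linorder} + 'n::{finite,linorder})) set \<Rightarrow> 'n set" where
  "jumps_I W = {i.
     dim (W \<inter> span (range (\<lambda>l. axis (Inl l) 1) \<union> (\<lambda>l. axis (Inr l) 1) ` {..i})) >
     dim (W \<inter> span (range (\<lambda>l. axis (Inl l) 1) \<union> (\<lambda>l. axis (Inr l) 1) ` {..<i}))}"

definition jumps_J :: "(real ^ 'm::{finite,linorder}) set \<Rightarrow> 'm set" where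
  "jumps_J W' = {j.
     dim (W' \<inter> span ((\<lambda>l. axis l 1) ` {j<..})) < dim (W' \<inter> span ((\<lambda>l. axis l 1) ` {j..}))}"

definition psi :: "real ^ ('m::{finite,linorder} + 'n::{finite,linorder}) \<Rightarrow>
    (real ^ ('m + 'n)) set \<Rightarrow> real" where
  "psi \<omega> W = (\<Sum>i\<in>jumps_I W. \<omega> $ Inr i)"

definition phi :: "real ^ ('m::{finite,linorder} + 'n::{finite,linorder}) \<Rightarrow>
    (real ^ 'm::{finite,linorder}) set \<Rightarrow> real" where
  "phi \<omega> W' = (\<Sum>j\<in>jumps_J W'. \<omega> $ Inl j)"

definition pencil :: "real ^ ('m::{finite,linorder} + 'n::{finite,linorder}) \<Rightarrow>
    (real ^ ('m + 'n)) set \<Rightarrow> real \<Rightarrow> real \<Rightarrow> (real ^ 'n::{finite,linorder} ^ 'm::{finite,linorder}) set" where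
  "pencil \<omega> W a b = {x.
     a \<le> psi \<omega> ({v. top_rows x *v v = 0} \<inter> W) \<and> phi \<omega> ((*v) (top_rows x) ` W) \<le> b}"

definition rational_subspace :: "(real ^ 'a::finite) set \<Rightarrow> bool" where
  "rational_subspace W \<longleftrightarrow>
     (\<exists>B. independent B \<and> span B = W \<and> (\<forall>v\<in>B. \<forall>i. v $ i \<in> \<rat>))"

definition in_proper_rational_weakly_constraining_pencil ::
  "real ^ ('m::{finite,linorder} + 'n::{finite,linorder}) \<Rightarrow> nat \<Rightarrow>
    (real ^ 'n::{finite,linorder} ^ 'm::{finite,linorder}) set \<Rightarrow> bool" where
  "in_proper_rational_weakly_constraining_pencil \<omega> k X \<longleftrightarrow>
     (\<exists>W a b. subspace W \<and> dim W = k \<and> rational_subspace W \<and> b \<le> a \<and>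
        pencil \<omega> W a b \<noteq> UNIV \<and> X \<subseteq> pencil \<omega> W a b)"

text \<open>
  Linear independence over \<open>\<rat>\<close> of \<open>1\<close> together with the family \<open>(\<xi>\<^sub>i)\<close>, \<open>i \<in> S\<close>; as a family,
  so repeated values are dependent.
\<close>

definition rat_independent_with_1 :: "real ^ 'm::finite \<Rightarrow> 'm set \<Rightarrow> bool" where
  "rat_independent_with_1 \<xi> S \<longleftrightarrow>
     (\<forall>(q0::rat) (q::'m \<Rightarrow> rat).
        of_rat q0 * 1 + (\<Sum>i\<in>S. of_rat (q i) * \<xi> $ i) = 0 \<longrightarrow> q0 = 0 \<and> (\<forall>i\<in>S. q i = 0))"

end

theory Submission
  imports Defs
begin

text \<open>
  A rational subspace \<open>W\<close> of dimension \<open>k\<close> cannot contain the kernel vector \<open>(-\<xi>, 1)\<close>: projecting to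
  the coordinates in \<open>S\<close> and the last one, \<open>k\<close> rational spanning vectors satisfy a common nontrivial
  rational linear relation in \<open>k + 1\<close> unknowns, which would be a relation between \<open>1\<close> and the
  \<open>\<xi>\<^sub>i\<close>, \<open>i \<in> S\<close>. Hence the first \<open>m\<close> rows of \<open>u(x)\<close> are injective on \<open>W\<close>, so \<open>\<psi> = 0 < \<phi>\<close> on the
  pencil data of \<open>W\<close>.

  If \<open>L\<close> is not connected at \<open>k\<close>, then \<open>\<lambda>\<^sub>k < \<lambda>\<^sub>k\<^sub>+\<^sub>1\<close> for all large \<open>t\<close>, and the span of the integer vectors
  that are shorter than \<open>\<lambda>\<^sub>k\<^sub>+\<^sub>1\<close> at time \<open>t\<close> is a \<open>k\<close>-dimensional rational subspace, locally constant
  in \<open>t\<close>, hence constant. By injectivity the flow expands this subspace exponentially, whereas by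
  Dirichlet's pigeonhole argument it contains a nonzero integer vector of bounded length at every
  time.
\<close>

subsection \<open>Successive minima of the image of the integer lattice\<close>

lemma infnorm_le_iff: "infnorm v \<le> r \<longleftrightarrow> (\<forall>i. \<bar>v $ i\<bar> \<le> r)" for v :: "real ^ 'a::finite"
proof
  show "infnorm v \<le> r \<Longrightarrow> \<forall>i. \<bar>v $ i\<bar> \<le> r"
    by (meson component_le_infnorm_cart order_trans)
  assume "\<forall>i. \<bar>v $ i\<bar> \<le> r"
  then show "infnorm v \<le> r"
    unfolding infnorm_cart by (intro cSup_least) auto
qed

lemma infnorm_ge_1_int_vector:
  fixes w :: "real ^ 'a::finite"
  assumes "w \<in> int_vectors" "w \<noteq> 0"
  shows "1 \<le> infnorm w"
proof -
  obtain i where "w $ i \<noteq> 0" using assms(2) by (auto simp: vec_eq_iff)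
  moreover have "w $ i \<in> \<int>" using assms(1) by (simp add: int_vectors_def)
  ultimately have "1 \<le> \<bar>w $ i\<bar>" by (simp add: Ints_nonzero_abs_ge1)
  then show ?thesis using component_le_infnorm_cart[of w i] by linarith
qed

lemma finite_int_vectors_infnorm_le:
  "finite {w \<in> int_vectors. infnorm (w :: real ^ 'a::finite) \<le> r}"
proof (rule finite_subset)
  let ?F = "PiE UNIV (\<lambda>_::'a. {z::real. z \<in> \<int> \<and> \<bar>z\<bar> \<le> r})"
  show "{w \<in> int_vectors. infnorm (w :: real ^ 'a) \<le> r} \<subseteq> vec_lambda ` ?F"
  proof
    fix w :: "real ^ 'a" assume "w \<in> {w \<in> int_vectors. infnorm w \<le> r}"
    then have "vec_nth w \<in> ?F" by (auto simp: int_vectors_def infnorm_le_iff)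
    then show "w \<in> vec_lambda ` ?F" by (intro image_eqI[of _ _ "vec_nth w"]) simp_all
  qed
  have "finite {z::real. z \<in> \<int> \<and> \<bar>z\<bar> \<le> r}"
    by (rule finite_abs_int_segment)
  then show "finite (vec_lambda ` ?F)" by (intro finite_imageI finite_PiE) auto
qed

text \<open>An injective linear map on a finite-dimensional space is bounded below, so a bound on
  the image is a bound on the integer vector itself, up to a constant.\<close>

lemma finite_lattice_infnorm_le:
  fixes f :: "real ^ 'a::finite \<Rightarrow> real ^ 'a"
  assumes "linear f" "inj f"
  shows "finite {w \<in> int_vectors. infnorm (f w) \<le> r}"
proof -
  obtain c where c: "c > 0" "\<And>w. c * norm w \<le> norm (f w)"
    using linear_inj_bounded_below_pos[OF assms] by blast
  let ?R = "sqrt (DIM(real ^ 'a)) * r / c"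
  have "infnorm w \<le> ?R" if "infnorm (f w) \<le> r" for w
  proof -
    have "c * infnorm w \<le> c * norm w" using c(1) infnorm_le_norm[of w] by simp
    also have "\<dots> \<le> norm (f w)" by (rule c(2))
    also have "\<dots> \<le> sqrt (DIM(real ^ 'a)) * infnorm (f w)" by (rule norm_le_infnorm)
    also have "\<dots> \<le> sqrt (DIM(real ^ 'a)) * r"
      using that by (intro mult_left_mono) auto
    finally show ?thesis using c(1) by (simp add: field_simps)
  qed
  then have "{w \<in> int_vectors. infnorm (f w) \<le> r} \<subseteq> {w \<in> int_vectors. infnorm w \<le> ?R}" by blast
  then show ?thesis by (rule finite_subset[OF _ finite_int_vectors_infnorm_le])
qed

text \<open>The cube has half side \<open>1 / 2\<close>; this is the origin of the factor 2 in front
  of \<open>infnorm\<close> in everything that follows.\<close>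

lemma mem_scaled_unit_cube:
  fixes v :: "real ^ 'a::finite"
  assumes "0 < r"
  shows "v \<in> (*\<^sub>R) r ` unit_cube \<longleftrightarrow> 2 * infnorm v \<le> r"
proof -
  have "v \<in> (*\<^sub>R) r ` unit_cube \<longleftrightarrow> v /\<^sub>R r \<in> unit_cube"
    using assms by (auto simp: image_iff intro!: bexI[of _ "v /\<^sub>R r"])
  also have "\<dots> \<longleftrightarrow> infnorm (v /\<^sub>R r) \<le> 1 / 2"
    unfolding unit_cube_def infnorm_le_iff by simp
  also have "\<dots> \<longleftrightarrow> 2 * infnorm v \<le> r"
    using assms by (simp add: infnorm_mul field_simps)
  finally show ?thesis .
qed

lemma independent_linear_inj_image_iff:
  assumes "linear f" "inj f"
  shows "independent (f ` B) \<longleftrightarrow> independent B"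
proof
  assume ind: "independent (f ` B)"
  show "independent B"
  proof
    assume "dependent B"
    then obtain a where a: "a \<in> B" "a \<in> span (B - {a})" unfolding dependent_def by blast
    have "f a \<in> span (f ` (B - {a}))"
      using a(2) linear_span_image[OF assms(1)] by blast
    also have "f ` (B - {a}) = f ` B - {f a}"
      using assms(2) a(1) by (auto dest: injD)
    finally show False using ind a(1) unfolding dependent_def by blast
  qed
next
  show "independent B \<Longrightarrow> independent (f ` B)"
    using assms by (intro linear_independent_injective_image) (auto intro: inj_on_subset)
qed

lemma finite_set_maximizer:
  fixes g :: "'b \<Rightarrow> real"
  assumes "finite B" "B \<noteq> {}"
  obtains w where "w \<in> B" "\<forall>v\<in>B. g v \<le> g w"
proof -
  obtain w where "w \<in> B" "Max (g ` B) = g w" using obtains_MAX[OF assms] by blast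
  then show thesis using that[of w] assms(1) Max_ge[of "g ` B"] by fastforce
qed

text \<open>Moves the condition inside \<open>succ_min\<close> from lattice vectors to their integer
  coordinates. Only the map \<open>f\<close> then depends on time, and one integer vector can be
  followed along the flow.\<close>

lemma lattice_ball_iff:
  fixes f :: "real ^ 'a::finite \<Rightarrow> real ^ 'a"
  assumes f: "linear f" "inj f" and "0 < r"
  shows "(\<exists>S \<subseteq> (*\<^sub>R) r ` unit_cube \<inter> f ` int_vectors. independent S \<and> card S = i) \<longleftrightarrow>
    (\<exists>B \<subseteq> int_vectors. independent B \<and> card B = i \<and> (\<forall>w\<in>B. 2 * infnorm (f w) \<le> r))"
    (is "?L \<longleftrightarrow> ?R")
proof
  assume ?L
  then obtain S where S: "S \<subseteq> (*\<^sub>R) r ` unit_cube \<inter> f ` int_vectors" "independent S" "card S = i"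
    by blast
  obtain B where B: "B \<subseteq> int_vectors" "S = f ` B"
    using S(1) by (meson le_inf_iff subset_imageE)
  have "inj_on f B" using f(2) by (rule inj_on_subset) simp
  then have "card B = i" using B S(3) by (simp add: card_image)
  moreover have "independent B"
    using S(2) B(2) independent_linear_inj_image_iff[OF f] by simp
  moreover have "\<forall>w\<in>B. 2 * infnorm (f w) \<le> r"
    using S(1) B(2) mem_scaled_unit_cube[OF \<open>0 < r\<close>] by blast
  ultimately show ?R using B(1) by blast
next
  assume ?R
  then obtain B where B: "B \<subseteq> int_vectors" "independent B" "card B = i"
    "\<forall>w\<in>B. 2 * infnorm (f w) \<le> r" by blast
  have "inj_on f B" using f(2) by (rule inj_on_subset) simp
  then have "card (f ` B) = i" using B by (simp add: card_image)
  moreover have "independent (f ` B)"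
    using B(2) independent_linear_inj_image_iff[OF f] by simp
  moreover have "f ` B \<subseteq> (*\<^sub>R) r ` unit_cube \<inter> f ` int_vectors"
    using B mem_scaled_unit_cube[OF \<open>0 < r\<close>] by blast
  ultimately show ?L by blast
qed

text \<open>\<open>LEAST\<close> over the reals means something only if the minimum is attained. Any
  admissible radius can be lowered to a value \<open>2 * infnorm (f w)\<close> with \<open>w\<close>
  integral, and only finitely many such values lie below a fixed bound.\<close>

lemma succ_min_is_least:
  fixes f :: "real ^ 'a::finite \<Rightarrow> real ^ 'a"
  assumes f: "linear f" "inj f" and i: "1 \<le> i" "i \<le> CARD('a)"
  defines "Q \<equiv> \<lambda>r. \<exists>B \<subseteq> int_vectors. independent B \<and> card B = i \<and> (\<forall>w\<in>B. 2 * infnorm (f w) \<le> r)"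
  shows "Q (succ_min i (f ` int_vectors))" "\<And>r. Q r \<Longrightarrow> succ_min i (f ` int_vectors) \<le> r"
proof -
  \<comment> \<open>The lowered radius comes from the longest vector of the family, which is nonzero
    because the family is independent.\<close>
  have refine: "\<exists>w\<in>int_vectors. 0 < 2 * infnorm (f w) \<and> 2 * infnorm (f w) \<le> r \<and> Q (2 * infnorm (f w))"
    if "Q r" for r
  proof -
    from that obtain B where B: "B \<subseteq> int_vectors" "independent B" "card B = i"
      "\<forall>w\<in>B. 2 * infnorm (f w) \<le> r" unfolding Q_def by blast
    have "finite B" "B \<noteq> {}" using B(2,3) i(1) independent_imp_finite by auto
    then obtain w where w: "w \<in> B" "\<forall>v\<in>B. infnorm (f v) \<le> infnorm (f w)"
      using finite_set_maximizer[of B "\<lambda>v. infnorm (f v)"] by blast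
    have "w \<noteq> 0" using B(2) w(1) dependent_zero by blast
    then have "f w \<noteq> 0" using linear_injective_0[OF f(1)] f(2) by blast
    then have "0 < infnorm (f w)" by (simp add: infnorm_pos_lt)
    moreover have "Q (2 * infnorm (f w))" unfolding Q_def using B w by (intro exI[of _ B]) auto
    ultimately show ?thesis using B w by (intro bexI[of _ w]) auto
  qed
  \<comment> \<open>Some radius is admissible: take \<open>i\<close> standard basis vectors and the
    largest value that \<open>2 * infnorm (f w)\<close> takes on them.\<close>
  obtain r0 where r0: "Q r0"
  proof -
    have "i \<le> card (Basis :: (real ^ 'a) set)" using i(2) by simp
    then obtain B :: "(real ^ 'a) set" where B: "B \<subseteq> Basis" "card B = i"
      using obtain_subset_with_card_n[of i "Basis :: (real ^ 'a) set"] by blast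
    have "B \<subseteq> int_vectors"
      using B(1) by (auto simp: int_vectors_def Basis_vec_def axis_def)
    moreover have "independent B" using B(1) independent_Basis independent_mono by blast
    moreover have "finite B" using B(1) finite_Basis finite_subset by blast
    then have "\<forall>w\<in>B. 2 * infnorm (f w) \<le> Max ((\<lambda>w. 2 * infnorm (f w)) ` B)" by simp
    ultimately show thesis using B(2) that unfolding Q_def by blast
  qed
  define F where "F = {2 * infnorm (f w) | w. w \<in> int_vectors \<and> infnorm (f w) \<le> r0 / 2}"
  have "F = (\<lambda>w. 2 * infnorm (f w)) ` {w \<in> int_vectors. infnorm (f w) \<le> r0 / 2}"
    unfolding F_def by blast
  then have fin: "finite F"
    by (simp only: finite_imageI finite_lattice_infnorm_le[OF f])
  define C where "C = {r \<in> F. 0 < r \<and> Q r}"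
  have C_fin: "finite C" using fin unfolding C_def by simp
  have in_C: "2 * infnorm (f w) \<in> C"
    if "w \<in> int_vectors" "0 < 2 * infnorm (f w)" "2 * infnorm (f w) \<le> r0" "Q (2 * infnorm (f w))" for w
    using that unfolding C_def F_def by auto
  then have "C \<noteq> {}" using refine[OF r0] by blast
  then have MinC: "Min C \<in> C" using C_fin by simp
  \<comment> \<open>Radii above \<open>r0\<close> need no refinement, since every element of
    \<open>C\<close> is at most \<open>r0\<close>.\<close>
  have least: "Min C \<le> r" if r: "Q r" for r
  proof (cases "r \<le> r0")
    case True
    obtain w where w: "w \<in> int_vectors" "0 < 2 * infnorm (f w)" "2 * infnorm (f w) \<le> r"
      "Q (2 * infnorm (f w))" using refine[OF r] by blast
    then have "2 * infnorm (f w) \<in> C" using True by (intro in_C) auto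
    then have "Min C \<le> 2 * infnorm (f w)" using C_fin by simp
    then show ?thesis using w(3) by simp
  next
    case False
    have "Min C \<le> r0" using MinC unfolding C_def F_def by auto
    then show ?thesis using False by simp
  qed
  have "succ_min i (f ` int_vectors) = Min C"
    unfolding succ_min_def
  proof (rule Least_equality)
    have "0 < Min C" "Q (Min C)" using MinC unfolding C_def by auto
    then show "0 < Min C \<and> (\<exists>S \<subseteq> (*\<^sub>R) (Min C) ` unit_cube \<inter> f ` int_vectors. independent S \<and> card S = i)"
      using lattice_ball_iff[OF f, of "Min C" i] unfolding Q_def by blast
  next
    fix r assume "0 < r \<and> (\<exists>S \<subseteq> (*\<^sub>R) r ` unit_cube \<inter> f ` int_vectors. independent S \<and> card S = i)"
    then have "Q r" using lattice_ball_iff[OF f, of r i] unfolding Q_def by blast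
    then show "Min C \<le> r" by (rule least)
  qed
  then show "Q (succ_min i (f ` int_vectors))" "\<And>r. Q r \<Longrightarrow> succ_min i (f ` int_vectors) \<le> r"
    using MinC least by (auto simp: C_def)
qed

lemma succ_min_attained:
  fixes f :: "real ^ 'a::finite \<Rightarrow> real ^ 'a"
  assumes "linear f" "inj f" "1 \<le> i" "i \<le> CARD('a)"
  obtains B where "B \<subseteq> int_vectors" "independent B" "card B = i"
    "\<And>w. w \<in> B \<Longrightarrow> 2 * infnorm (f w) \<le> succ_min i (f ` int_vectors)"
  using succ_min_is_least(1)[OF assms] by blast

lemma succ_min_mono:
  fixes f :: "real ^ 'a::finite \<Rightarrow> real ^ 'a"
  assumes f: "linear f" "inj f" and "1 \<le> i" "i \<le> j" "j \<le> CARD('a)"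
  shows "succ_min i (f ` int_vectors) \<le> succ_min j (f ` int_vectors)"
proof -
  obtain B where B: "B \<subseteq> int_vectors" "independent B" "card B = j"
    "\<And>w. w \<in> B \<Longrightarrow> 2 * infnorm (f w) \<le> succ_min j (f ` int_vectors)"
    using succ_min_attained[OF f, of j] assms by auto
  obtain B' where B': "B' \<subseteq> B" "card B' = i"
    using obtain_subset_with_card_n[of i B] B(3) \<open>i \<le> j\<close> by blast
  then have "independent B'" using B(2) independent_mono by blast
  then have "\<exists>B \<subseteq> int_vectors. independent B \<and> card B = i \<and>
      (\<forall>w\<in>B. 2 * infnorm (f w) \<le> succ_min j (f ` int_vectors))"
    using B B' by (intro exI[of _ B']) blast
  then show ?thesis using assms by (intro succ_min_is_least(2)[OF f]) auto
qed

section \<open>The span of the vectors shorter than the next minimum\<close>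

definition low_span :: "(real ^ 'a::finite \<Rightarrow> real ^ 'a) \<Rightarrow> nat \<Rightarrow> (real ^ 'a) set" where
  "low_span f k = span {w \<in> int_vectors. 2 * infnorm (f w) < succ_min (k + 1) (f ` int_vectors)}"

text \<open>Among \<open>k + 1\<close> independent integer vectors strictly below the minimum of
  index \<open>k + 1\<close>, the longest would give a smaller admissible radius. So these vectors
  span at most \<open>k\<close> dimensions, and \<open>k\<close> independent ones exhaust the
  span.\<close>

lemma low_span_eq:
  fixes f :: "real ^ 'a::finite \<Rightarrow> real ^ 'a"
  assumes f: "linear f" "inj f" and k: "k < CARD('a)"
    and B: "B \<subseteq> int_vectors" "independent B" "card B = k"
    and less: "\<And>w. w \<in> B \<Longrightarrow> 2 * infnorm (f w) < succ_min (k + 1) (f ` int_vectors)"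
  shows "low_span f k = span B"
proof -
  let ?A = "{w \<in> int_vectors. 2 * infnorm (f w) < succ_min (k + 1) (f ` int_vectors)}"
  have "dim ?A \<le> k"
  proof (rule ccontr)
    assume "\<not> dim ?A \<le> k"
    moreover obtain C where C: "C \<subseteq> ?A" "independent C" "card C = dim ?A"
      by (meson basis_exists)
    ultimately obtain D where D: "D \<subseteq> C" "card D = k + 1"
      using obtain_subset_with_card_n[of "k + 1" C] by (metis Suc_eq_plus1 not_less_eq_eq)
    have D': "finite D" "D \<noteq> {}" using D(2) card_gt_0_iff[of D] by auto
    then obtain w where w: "w \<in> D" "\<forall>v\<in>D. infnorm (f v) \<le> infnorm (f w)"
      using finite_set_maximizer[of D "\<lambda>v. infnorm (f v)"] by blast
    have "independent D" using independent_mono[OF C(2) D(1)] .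
    then have "\<exists>B \<subseteq> int_vectors. independent B \<and> card B = k + 1 \<and>
        (\<forall>v\<in>B. 2 * infnorm (f v) \<le> 2 * infnorm (f w))"
      using C(1) D w(2) by (intro exI[of _ D]) auto
    then have "succ_min (k + 1) (f ` int_vectors) \<le> 2 * infnorm (f w)"
      using k by (intro succ_min_is_least(2)[OF f]) auto
    then show False using w(1) D(1) C(1) by force
  qed
  then have "span B = span ?A"
    using B less by (intro subspace_dim_equal span_mono subspace_span) (auto simp: dim_eq_card_independent)
  then show ?thesis by (simp add: low_span_def)
qed

text \<open>A vector \<open>w\<close> below the minimum of index \<open>k + 1\<close> lies in the
  span already. Otherwise any vector realizing the minimum of index \<open>k\<close> is shorter than
  \<open>w\<close> by the gap, and replaces it.\<close>

lemma low_span_short_vector: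
  fixes f :: "real ^ 'a::finite \<Rightarrow> real ^ 'a"
  assumes f: "linear f" "inj f" and k: "1 \<le> k" "k < CARD('a)"
    and gap: "succ_min k (f ` int_vectors) < succ_min (k + 1) (f ` int_vectors)"
    and w: "w \<in> int_vectors" "w \<noteq> 0" "infnorm (f w) \<le> c"
  obtains v where "v \<in> low_span f k" "v \<in> int_vectors" "v \<noteq> 0" "infnorm (f v) \<le> c"
proof (cases "2 * infnorm (f w) < succ_min (k + 1) (f ` int_vectors)")
  case True
  then show ?thesis using w that[of w] by (simp add: low_span_def span_base)
next
  case False
  obtain B where B: "B \<subseteq> int_vectors" "independent B" "card B = k"
    "\<And>w. w \<in> B \<Longrightarrow> 2 * infnorm (f w) \<le> succ_min k (f ` int_vectors)"
    using succ_min_attained[OF f, of k] k by auto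
  obtain v where v: "v \<in> B" using B(3) k(1) by fastforce
  have "v \<noteq> 0" using B(2) v dependent_zero by blast
  moreover have v': "2 * infnorm (f v) < succ_min (k + 1) (f ` int_vectors)"
    using B(4)[OF v] gap by simp
  moreover have "v \<in> low_span f k"
    using v v' B(1) by (auto simp: low_span_def intro: span_base)
  ultimately show ?thesis using False w(3) B(1) v that[of v] by auto
qed

subsection \<open>The flow on lattice vectors\<close>

text \<open>The flow written on integer coordinates: the lattice at time \<open>t\<close> is the
  image of the fixed set \<open>int_vectors\<close>, and all the time dependence sits in this
  map.\<close>

definition flow ::
  "real ^ ('m::finite + 'n::finite) \<Rightarrow> real ^ 'n ^ 'm \<Rightarrow> real \<Rightarrow> real ^ ('m + 'n) \<Rightarrow> real ^ ('m + 'n)"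
  where "flow \<omega> x t w = diag_flow \<omega> t *v (unip x *v w)"

lemma sum_UNIV_Plus:
  fixes g :: "'a::finite + 'b::finite \<Rightarrow> 'c::comm_monoid_add"
  shows "sum g UNIV = (\<Sum>i\<in>UNIV. g (Inl i)) + (\<Sum>j\<in>UNIV. g (Inr j))"
  by (simp add: UNIV_Plus_UNIV[symmetric] sum.Plus del: UNIV_Plus_UNIV)

lemma top_rows_nth: "(top_rows x *v w) $ i = w $ Inl i + (\<Sum>j\<in>UNIV. x $ i $ j * w $ Inr j)"
  by (simp add: matrix_vector_mult_def top_rows_def unip_def sum_UNIV_Plus if_distrib
      if_distribR cong: if_cong)

lemma unip_nth_Inl: "(unip x *v w) $ Inl i = (top_rows x *v w) $ i"
  by (simp add: matrix_vector_mult_def top_rows_def)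

lemma unip_nth_Inr: "(unip x *v w) $ Inr j = w $ Inr j"
  by (simp add: matrix_vector_mult_def unip_def sum_UNIV_Plus if_distrib if_distribR cong: if_cong)

lemma flow_nth_Inl: "flow \<omega> x t w $ Inl i = exp (\<omega> $ Inl i * t) * (top_rows x *v w) $ i"
proof -
  have "(diag_flow \<omega> t *v v) $ Inl i = exp (\<omega> $ Inl i * t) * v $ Inl i" for v
    by (simp add: diag_flow_def matrix_vector_mult_def mult_delta_left)
  then show ?thesis by (simp add: flow_def unip_nth_Inl)
qed

lemma flow_nth_Inr: "flow \<omega> x t w $ Inr j = exp (- \<omega> $ Inr j * t) * w $ Inr j"
proof -
  have "(diag_flow \<omega> t *v v) $ Inr j = exp (- \<omega> $ Inr j * t) * v $ Inr j" for v
    by (simp add: diag_flow_def matrix_vector_mult_def mult_delta_left)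
  then show ?thesis by (simp add: flow_def unip_nth_Inr)
qed

lemma linear_flow: "linear (flow \<omega> x t)"
  by (rule linearI) (simp_all add: flow_def matrix_vector_mult_scaleR matrix_vector_right_distrib)

lemma inj_flow: "inj (flow \<omega> x t)"
proof -
  have "w = 0" if "flow \<omega> x t w = 0" for w
  proof -
    have r: "w $ Inr j = 0" for j
      using flow_nth_Inr[of \<omega> x t w j] that by simp
    moreover have "w $ Inl i = 0" for i
      using flow_nth_Inl[of \<omega> x t w i] that r by (simp add: top_rows_nth)
    ultimately show "w = 0" by (metis vec_eq_iff sum.exhaust zero_index)
  qed
  then show ?thesis using linear_injective_0[OF linear_flow] by blast
qed

lemma log_min_lattice_of:
  "log_min \<omega> (lattice_of x) i t = ln (succ_min i (flow \<omega> x t ` int_vectors))"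
  by (simp add: log_min_def lattice_of_def flow_def[abs_def] image_image)

text \<open>Passing from time \<open>s\<close> to time \<open>t\<close> multiplies each coordinate
  by the exponential of plus or minus its weight times \<open>t - s\<close>, and
  \<open>infnorm \<omega>\<close> bounds all weights at once.\<close>

lemma infnorm_flow_le:
  "infnorm (flow \<omega> x t w) \<le> exp (infnorm \<omega> * \<bar>t - s\<bar>) * infnorm (flow \<omega> x s w)"
  unfolding infnorm_le_iff[of "flow \<omega> x t w"]
proof
  fix k
  let ?E = "exp (infnorm \<omega> * \<bar>t - s\<bar>)"
  have "\<bar>\<omega> $ k * (t - s)\<bar> \<le> infnorm \<omega> * \<bar>t - s\<bar>"
    unfolding abs_mult by (intro mult_right_mono component_le_infnorm_cart) simp
  then have le: "\<omega> $ k * (t - s) \<le> infnorm \<omega> * \<bar>t - s\<bar>" "- \<omega> $ k * (t - s) \<le> infnorm \<omega> * \<bar>t - s\<bar>"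
    by (simp_all add: abs_le_iff)
  have "\<bar>flow \<omega> x t w $ k\<bar> \<le> ?E * \<bar>flow \<omega> x s w $ k\<bar>"
  proof (cases k)
    case (Inl i)
    have "exp (\<omega> $ Inl i * t) = exp (\<omega> $ Inl i * (t - s)) * exp (\<omega> $ Inl i * s)"
      by (simp add: exp_add[symmetric] algebra_simps)
    then have "exp (\<omega> $ Inl i * t) \<le> ?E * exp (\<omega> $ Inl i * s)" using le Inl by simp
    from mult_right_mono[OF this, of "\<bar>(top_rows x *v w) $ i\<bar>"] show ?thesis
      using Inl by (simp add: flow_nth_Inl abs_mult mult.assoc)
  next
    case (Inr j)
    have "exp (- \<omega> $ Inr j * t) = exp (- \<omega> $ Inr j * (t - s)) * exp (- \<omega> $ Inr j * s)"
      by (simp add: exp_add[symmetric] algebra_simps)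
    then have "exp (- \<omega> $ Inr j * t) \<le> ?E * exp (- \<omega> $ Inr j * s)" using le Inr by simp
    from mult_right_mono[OF this, of "\<bar>w $ Inr j\<bar>"] show ?thesis
      using Inr by (simp add: flow_nth_Inr abs_mult mult.assoc)
  qed
  also have "\<dots> \<le> ?E * infnorm (flow \<omega> x s w)"
    by (intro mult_left_mono component_le_infnorm_cart) simp
  finally show "\<bar>flow \<omega> x t w $ k\<bar> \<le> ?E * infnorm (flow \<omega> x s w)" .
qed

text \<open>A gap at time \<open>s\<close> survives small changes of time: the family
  \<open>B\<close> realizing the minimum of index \<open>k\<close> at time \<open>s\<close> remains
  below the minimum of index \<open>k + 1\<close> at time \<open>t\<close>, so the same
  \<open>B\<close> spans the subspace at both times.\<close>

lemma low_span_flow_locally_constant: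
  fixes \<omega> :: "real ^ ('m::finite + 'n::finite)"
  assumes k: "1 \<le> k" "k < CARD('m + 'n)"
    and gap: "succ_min k (flow \<omega> x s ` int_vectors) < succ_min (k + 1) (flow \<omega> x s ` int_vectors)"
  obtains \<delta> where "0 < \<delta>" "\<And>t. \<bar>t - s\<bar> < \<delta> \<Longrightarrow> low_span (flow \<omega> x t) k = low_span (flow \<omega> x s) k"
proof -
  let ?sm = "\<lambda>i t. succ_min i (flow \<omega> x t ` int_vectors)"
  let ?M = "infnorm \<omega>"
  obtain B where B: "B \<subseteq> int_vectors" "independent B" "card B = k"
    "\<And>w. w \<in> B \<Longrightarrow> 2 * infnorm (flow \<omega> x s w) \<le> ?sm k s"
    using succ_min_attained[OF linear_flow inj_flow k(1) less_imp_le[OF k(2)]] by blast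
  \<comment> \<open>One exponential factor pays for the growth of the vectors of \<open>B\<close>,
    the other for the possible decrease of the minimum of index \<open>k + 1\<close>.\<close>
  have "((\<lambda>\<epsilon>. exp (?M * \<epsilon>) * ?sm k s * exp (?M * \<epsilon>)) \<longlongrightarrow> exp (?M * 0) * ?sm k s * exp (?M * 0)) (at_right 0)"
    by (intro tendsto_intros)
  then have "\<forall>\<^sub>F \<epsilon> in at_right 0. exp (?M * \<epsilon>) * ?sm k s * exp (?M * \<epsilon>) < ?sm (k + 1) s"
    using gap by (intro order_tendstoD) auto
  then obtain \<delta> where \<delta>: "0 < \<delta>" "\<And>\<epsilon>. 0 < \<epsilon> \<Longrightarrow> \<epsilon> < \<delta> \<Longrightarrow> exp (?M * \<epsilon>) * ?sm k s * exp (?M * \<epsilon>) < ?sm (k + 1) s"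
    unfolding eventually_at_right_field by blast
  have "low_span (flow \<omega> x t) k = low_span (flow \<omega> x s) k" if t: "\<bar>t - s\<bar> < \<delta>" for t
  proof -
    let ?E = "exp (?M * \<bar>t - s\<bar>)"
    \<comment> \<open>The bound near 0 from the right covers positive distances only; at
      \<open>t = s\<close> it is the gap itself.\<close>
    have E: "?E * ?sm k s * ?E < ?sm (k + 1) s"
      using \<delta>(2)[of "\<bar>t - s\<bar>"] t gap by (cases "t = s") auto
    have k1: "k + 1 \<le> CARD('m + 'n)" using k(2) by linarith
    \<comment> \<open>Carrying a family realizing the minimum of index \<open>k + 1\<close> at time
      \<open>t\<close> back to time \<open>s\<close> shows that this minimum drops by at most the
      factor \<open>?E\<close>.\<close>
    obtain D where D: "D \<subseteq> int_vectors" "independent D" "card D = k + 1"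
      "\<And>w. w \<in> D \<Longrightarrow> 2 * infnorm (flow \<omega> x t w) \<le> ?sm (k + 1) t"
      using succ_min_attained[OF linear_flow inj_flow le_add2 k1] by blast
    have "2 * infnorm (flow \<omega> x s w) \<le> ?E * ?sm (k + 1) t" if "w \<in> D" for w
    proof -
      have "2 * infnorm (flow \<omega> x s w) \<le> ?E * (2 * infnorm (flow \<omega> x t w))"
        using infnorm_flow_le[of \<omega> x s w t] by (simp add: abs_minus_commute)
      also have "\<dots> \<le> ?E * ?sm (k + 1) t" using D(4)[OF that] by simp
      finally show ?thesis .
    qed
    then have "\<exists>B \<subseteq> int_vectors. independent B \<and> card B = k + 1 \<and>
        (\<forall>w\<in>B. 2 * infnorm (flow \<omega> x s w) \<le> ?E * ?sm (k + 1) t)"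
      using D(1-3) by (intro exI[of _ D]) blast
    then have "?sm (k + 1) s \<le> ?E * ?sm (k + 1) t"
      using k by (intro succ_min_is_least(2)[OF linear_flow inj_flow]) auto
    then have "?E * (?E * ?sm k s) < ?E * ?sm (k + 1) t"
      using E mult.commute[of "?E * ?sm k s" ?E] by linarith
    then have gap': "?E * ?sm k s < ?sm (k + 1) t" by simp
    have "2 * infnorm (flow \<omega> x t w) < ?sm (k + 1) t" if "w \<in> B" for w
    proof -
      have "2 * infnorm (flow \<omega> x t w) \<le> ?E * (2 * infnorm (flow \<omega> x s w))"
        using infnorm_flow_le[of \<omega> x t w s] by simp
      also have "\<dots> \<le> ?E * ?sm k s" using B(4)[OF that] by simp
      finally show ?thesis using gap' by simp
    qed
    then have "low_span (flow \<omega> x t) k = span B"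
      using B k by (intro low_span_eq linear_flow inj_flow) auto
    moreover have "low_span (flow \<omega> x s) k = span B"
      using B gap k by (intro low_span_eq linear_flow inj_flow) fastforce+
    ultimately show ?thesis by simp
  qed
  then show thesis using \<delta>(1) that by blast
qed

text \<open>A locally constant function on the connected half-line beyond \<open>T\<close> is
  constant.\<close>

lemma low_span_flow_constant:
  fixes \<omega> :: "real ^ ('m::finite + 'n::finite)"
  assumes k: "1 \<le> k" "k < CARD('m + 'n)"
    and gap: "\<And>t. T < t \<Longrightarrow>
      succ_min k (flow \<omega> x t ` int_vectors) < succ_min (k + 1) (flow \<omega> x t ` int_vectors)"
    and "T < s" "T < t"
  shows "low_span (flow \<omega> x s) k = low_span (flow \<omega> x t) k"
proof (rule connected_equivalence_relation[where S = "{T<..}"])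
  fix a assume a: "a \<in> {T<..}"
  obtain \<delta> where \<delta>: "0 < \<delta>"
    "\<And>t. \<bar>t - a\<bar> < \<delta> \<Longrightarrow> low_span (flow \<omega> x t) k = low_span (flow \<omega> x a) k"
    using low_span_flow_locally_constant[OF k gap[of a]] a greaterThan_iff by metis
  show "\<exists>U. openin (top_of_set {T<..}) U \<and> a \<in> U \<and>
      (\<forall>b\<in>U. low_span (flow \<omega> x a) k = low_span (flow \<omega> x b) k)"
  proof (intro exI[of _ "{T<..} \<inter> ball a \<delta>"] conjI ballI)
    show "openin (top_of_set {T<..}) ({T<..} \<inter> ball a \<delta>)" by (intro openin_open_Int) simp
    show "a \<in> {T<..} \<inter> ball a \<delta>" using a \<delta>(1) by simp
    fix b assume "b \<in> {T<..} \<inter> ball a \<delta>"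
    then have "\<bar>b - a\<bar> < \<delta>" by (simp add: dist_real_def abs_minus_commute)
    then show "low_span (flow \<omega> x a) k = low_span (flow \<omega> x b) k" using \<delta>(2)[of b] by simp
  qed
qed (use assms in simp_all)

text \<open>A linear map injective on the subspace \<open>W\<close> is bounded below there, and the
  flow multiplies each coordinate of \<open>top_rows x *v w\<close> by at least
  \<open>exp (\<delta> * t)\<close>.\<close>

lemma infnorm_flow_ge:
  fixes \<omega> :: "real ^ ('m::finite + 'n::finite)"
  assumes W: "subspace W" "\<And>w. w \<in> W \<Longrightarrow> top_rows x *v w = 0 \<Longrightarrow> w = 0"
    and \<delta>: "\<And>i. \<delta> \<le> \<omega> $ Inl i"
  obtains c where "0 < c"
    "\<And>w t. w \<in> W \<Longrightarrow> 0 \<le> t \<Longrightarrow> c * exp (\<delta> * t) * infnorm w \<le> infnorm (flow \<omega> x t w)"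
proof -
  have "bounded_linear ((*v) (top_rows x))" by (rule matrix_vector_mul_bounded_linear)
  then obtain e where e: "e > 0" "\<forall>w\<in>W. e * norm w \<le> norm (top_rows x *v w)"
    using injective_imp_isometric[OF closed_subspace[OF W(1)] W(1)] W(2) by blast
  \<comment> \<open>The factor relating the Euclidean norm to \<open>infnorm\<close> on the target
    space.\<close>
  define D where "D = sqrt (DIM(real ^ 'm))"
  have D: "D > 0" by (simp add: D_def)
  have "e / D * exp (\<delta> * t) * infnorm w \<le> infnorm (flow \<omega> x t w)" if w: "w \<in> W" "0 \<le> t" for w t
  proof -
    have "e * infnorm w \<le> e * norm w" using e(1) infnorm_le_norm[of w] by simp
    also have "\<dots> \<le> norm (top_rows x *v w)" using e(2) w by blast
    also have "\<dots> \<le> D * infnorm (top_rows x *v w)" unfolding D_def by (rule norm_le_infnorm)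
    finally have 1: "e / D * infnorm w \<le> infnorm (top_rows x *v w)"
      using D by (simp add: field_simps)
    have "infnorm (top_rows x *v w) \<le> infnorm (flow \<omega> x t w) / exp (\<delta> * t)"
      unfolding infnorm_le_iff[of "top_rows x *v w"]
    proof
      fix i
      have "exp (\<delta> * t) \<le> exp (\<omega> $ Inl i * t)" using \<delta> w by (simp add: mult_right_mono)
      then have "exp (\<delta> * t) * \<bar>(top_rows x *v w) $ i\<bar> \<le> \<bar>flow \<omega> x t w $ Inl i\<bar>"
        by (simp add: flow_nth_Inl abs_mult mult_right_mono)
      also have "\<dots> \<le> infnorm (flow \<omega> x t w)" by (rule component_le_infnorm_cart)
      finally show "\<bar>(top_rows x *v w) $ i\<bar> \<le> infnorm (flow \<omega> x t w) / exp (\<delta> * t)"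
        by (simp add: pos_le_divide_eq mult.commute)
    qed
    then have "exp (\<delta> * t) * infnorm (top_rows x *v w) \<le> infnorm (flow \<omega> x t w)"
      by (simp add: pos_le_divide_eq mult.commute)
    moreover have "exp (\<delta> * t) * (e / D * infnorm w) \<le> exp (\<delta> * t) * infnorm (top_rows x *v w)"
      using 1 by (intro mult_left_mono) auto
    ultimately show ?thesis by (simp add: mult_ac)
  qed
  then show thesis using e(1) D that[of "e / D"] by simp
qed

subsection \<open>Rational relations and Diophantine approximation\<close>

text \<open>Gaussian elimination by induction on the equations. An arbitrary field is allowed so
  that rational coefficients yield a rational solution.\<close>

lemma homogeneous_system_nontrivial_solution:
  fixes a :: "'j \<Rightarrow> 'i \<Rightarrow> 'k::field"
  assumes "finite J" "finite I" "card J < card I"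
  shows "\<exists>q. (\<exists>i\<in>I. q i \<noteq> 0) \<and> (\<forall>j\<in>J. (\<Sum>i\<in>I. a j i * q i) = 0)"
  using assms
proof (induction J arbitrary: I a rule: finite_induct)
  case empty
  then have "I \<noteq> {}" by auto
  then show ?case by (intro exI[of _ "\<lambda>_. 1"]) auto
next
  case (insert j J)
  show ?case
  proof (cases "\<forall>i\<in>I. a j i = 0")
    case True
    obtain q where "\<exists>i\<in>I. q i \<noteq> 0" "\<forall>j\<in>J. (\<Sum>i\<in>I. a j i * q i) = 0"
      using insert.IH[of I a] insert.prems insert.hyps by auto
    then show ?thesis using True by (intro exI[of _ q]) auto
  next
    case False
    then obtain p where p: "p \<in> I" "a j p \<noteq> 0" by blast
    define I' where "I' = I - {p}"
    have I': "finite I'" "I = insert p I'" "p \<notin> I'" using p insert.prems by (auto simp: I'_def)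
    \<comment> \<open>Equation \<open>j\<close> is solved for the pivot unknown \<open>p\<close>;
      substituting into the other equations removes one equation and one unknown.\<close>
    have "card J < card I'" using I' insert.prems insert.hyps by auto
    then obtain q where q: "\<exists>i\<in>I'. q i \<noteq> 0"
      "\<forall>l\<in>J. (\<Sum>i\<in>I'. (a l i - a l p * a j i / a j p) * q i) = 0"
      using insert.IH[OF I'(1), of "\<lambda>l i. a l i - a l p * a j i / a j p"] by auto
    define s where "s = (\<Sum>i\<in>I'. a j i * q i)"
    \<comment> \<open>Back substitution: the value at \<open>p\<close> is the one that makes
      equation \<open>j\<close> hold.\<close>
    define q' where "q' = q(p := - s / a j p)"
    have sum': "(\<Sum>i\<in>I. a l i * q' i) = (\<Sum>i\<in>I'. a l i * q i) - a l p * s / a j p" for l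
    proof -
      have "(\<Sum>i\<in>I'. a l i * q' i) = (\<Sum>i\<in>I'. a l i * q i)"
        using I'(3) by (intro sum.cong) (auto simp: q'_def)
      then show ?thesis using I' by (simp add: q'_def)
    qed
    have "(\<Sum>i\<in>I. a j i * q' i) = 0" using p(2) by (simp add: sum' s_def)
    moreover have "(\<Sum>i\<in>I. a l i * q' i) = 0" if "l \<in> J" for l
    proof -
      have "(\<Sum>i\<in>I'. (a l i - a l p * a j i / a j p) * q i) =
          (\<Sum>i\<in>I'. a l i * q i - a l p / a j p * (a j i * q i))"
        by (intro sum.cong) (auto simp: algebra_simps)
      also have "\<dots> = (\<Sum>i\<in>I'. a l i * q i) - a l p * s / a j p"
        by (simp add: sum_subtractf s_def sum_distrib_left sum_divide_distrib)
      finally show ?thesis using q(2) that by (simp add: sum')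
    qed
    moreover have "\<exists>i\<in>I. q' i \<noteq> 0" using q(1) I' by (auto simp: q'_def)
    ultimately show ?thesis by (intro exI[of _ q']) auto
  qed
qed

text \<open>The vectors of \<open>B\<close> impose at most \<open>card S\<close> rational equations
  on the \<open>card S + 1\<close> coefficients of a linear form in the coordinates \<open>S\<close>
  and the last one. A nonzero solution vanishes on \<open>span B\<close>, while on a multiple of
  \<open>(-\<xi>, 1)\<close> it is a relation between 1 and the entries of \<open>\<xi>\<close> over
  \<open>S\<close>.\<close>

lemma span_rational_avoids:
  fixes \<xi> :: "real ^ 'm::finite" and v :: "real ^ ('m + 1)"
  assumes B: "finite B" "\<And>b i. b \<in> B \<Longrightarrow> b $ i \<in> \<rat>" and S: "card B \<le> card S"
    and ind: "rat_independent_with_1 \<xi> S"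
    and v: "v \<in> span B" "\<And>i. v $ Inl i = - \<xi> $ i * v $ Inr 1"
  shows "v = 0"
proof -
  define r :: "real ^ ('m + 1) \<Rightarrow> 'm + 1 \<Rightarrow> rat" where "r b i = (SOME z. b $ i = of_rat z)" for b i
  have r: "of_rat (r b i) = b $ i" if "b \<in> B" for b i
    using someI_ex[of "\<lambda>z. b $ i = of_rat z"] B(2)[OF that, of i] unfolding r_def Rats_def by auto
  define I :: "('m + 1) set" where "I = insert (Inr 1) (Inl ` S)"
  have "card I = card S + 1"
    unfolding I_def by (subst card_insert_disjoint) (auto simp: card_image)
  then obtain q where q: "\<exists>i\<in>I. q i \<noteq> 0" "\<forall>b\<in>B. (\<Sum>i\<in>I. r b i * q i) = 0"
    using homogeneous_system_nontrivial_solution[OF B(1), of I r] S by (auto simp: I_def)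
  have sumI: "sum g I = g (Inr 1) + (\<Sum>i\<in>S. g (Inl i))" for g :: "'m + 1 \<Rightarrow> real"
    unfolding I_def by (subst sum.insert) (auto simp: sum.reindex)
  \<comment> \<open>The zero set of the linear form is a subspace containing \<open>B\<close>, hence
    all of \<open>span B\<close>.\<close>
  have "(\<Sum>i\<in>I. of_rat (q i) * v $ i) = (0::real)"
    using v(1)
  proof (induction rule: span_induct)
    case base
    show ?case
      by (rule subspaceI) (auto simp: algebra_simps sum.distrib scaleR_sum_right[symmetric] sum_distrib_left[symmetric])
  next
    case (step b)
    then have "(\<Sum>i\<in>I. of_rat (q i) * b $ i) = (of_rat (\<Sum>i\<in>I. r b i * q i) :: real)"
      by (simp add: of_rat_sum of_rat_mult r mult.commute)
    then show ?case using q(2) step by simp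
  qed
  \<comment> \<open>Inserting the shape of \<open>v\<close> factors out its last coordinate; by
    independence the other factor is nonzero.\<close>
  then have "v $ Inr 1 * (of_rat (q (Inr 1)) * 1 + (\<Sum>i\<in>S. of_rat (- q (Inl i)) * \<xi> $ i)) = 0"
    by (simp add: sumI v(2) algebra_simps sum_distrib_left of_rat_minus sum_negf)
  moreover have "of_rat (q (Inr 1)) * 1 + (\<Sum>i\<in>S. of_rat (- q (Inl i)) * \<xi> $ i) \<noteq> 0"
  proof
    assume "of_rat (q (Inr 1)) * 1 + (\<Sum>i\<in>S. of_rat (- q (Inl i)) * \<xi> $ i) = 0"
    then have "q (Inr 1) = 0 \<and> (\<forall>i\<in>S. - q (Inl i) = 0)"
      using ind[unfolded rat_independent_with_1_def, rule_format, of "q (Inr 1)" "\<lambda>i. - q (Inl i)"]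
      by blast
    then show False using q(1) by (auto simp: I_def)
  qed
  ultimately have "v $ Inr 1 = 0" by simp
  moreover have "v $ Inl i = 0" for i using v(2)[of i] calculation by simp
  ultimately show "v = 0" unfolding vec_eq_iff
    by (metis (full_types) num1_eq_iff sum.exhaust zero_index)
qed

text \<open>Dirichlet's box principle with a separate number of cells \<open>N i\<close> in each
  coordinate, as unequal weights require.\<close>

lemma simultaneous_approximation:
  fixes \<xi> :: "'m::finite \<Rightarrow> real" and N :: "'m \<Rightarrow> nat"
  assumes N: "\<And>i. 0 < N i"
  obtains q :: nat and p :: "'m \<Rightarrow> int"
  where "0 < q" "q \<le> (\<Prod>i\<in>UNIV. N i)" "\<And>i. real (N i) * \<bar>q * \<xi> i + p i\<bar> \<le> 1"
proof -
  let ?P = "\<Prod>i\<in>UNIV. N i"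
  \<comment> \<open>\<open>g q\<close> is the box containing the fractional parts of
    \<open>q * \<xi> i\<close>. There are \<open>?P\<close> boxes, and \<open>q\<close> runs through
    the \<open>?P + 1\<close> values from 0 to \<open>?P\<close>.\<close>
  define g where "g q = (\<lambda>i. nat \<lfloor>N i * frac (real q * \<xi> i)\<rfloor>)" for q :: nat
  have "g ` {..?P} \<subseteq> PiE UNIV (\<lambda>i. {..<N i})"
  proof clarify
    fix q
    have "nat \<lfloor>N i * frac (real q * \<xi> i)\<rfloor> < N i" for i
    proof -
      have "N i * frac (real q * \<xi> i) < real (N i) * 1"
        using N[of i] by (intro mult_strict_left_mono frac_lt_1) auto
      then have "\<lfloor>N i * frac (real q * \<xi> i)\<rfloor> < int (N i)" by (simp add: floor_less_iff)
      then show ?thesis using N[of i] by simp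
    qed
    then show "g q \<in> PiE UNIV (\<lambda>i. {..<N i})" by (auto simp: g_def)
  qed
  then have "card (g ` {..?P}) \<le> card (PiE UNIV (\<lambda>i. {..<N i}))"
    by (intro card_mono finite_PiE) auto
  also have "\<dots> = ?P" by (simp add: card_PiE)
  also have "\<dots> < card {..?P}" by simp
  finally have "\<not> inj_on g {..?P}" by (rule pigeonhole)
  then obtain q1 q2 where qs: "q1 \<le> ?P" "q2 \<le> ?P" "q1 < q2" "g q1 = g q2"
    unfolding inj_on_def by (metis atMost_iff linorder_neqE_nat)
  show thesis
  \<comment> \<open>With this choice of \<open>p\<close>, the error is exactly the difference of the
    two fractional parts, which share a cell.\<close>
  proof (rule that[of "q2 - q1" "\<lambda>i. \<lfloor>real q1 * \<xi> i\<rfloor> - \<lfloor>real q2 * \<xi> i\<rfloor>"])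
    show "0 < q2 - q1" "q2 - q1 \<le> ?P" using qs by auto
    fix i
    let ?f = "\<lambda>q. N i * frac (real q * \<xi> i)"
    have "0 \<le> ?f q1" "0 \<le> ?f q2" by simp_all
    moreover have "nat \<lfloor>?f q1\<rfloor> = nat \<lfloor>?f q2\<rfloor>"
      using fun_cong[OF qs(4), of i] by (simp add: g_def)
    ultimately have "\<lfloor>?f q1\<rfloor> = \<lfloor>?f q2\<rfloor>" by (metis nat_eq_iff zero_le_floor)
    then have "\<bar>?f q2 - ?f q1\<bar> \<le> 1" by linarith
    moreover have "?f q2 - ?f q1 =
        N i * (real (q2 - q1) * \<xi> i + real_of_int (\<lfloor>real q1 * \<xi> i\<rfloor> - \<lfloor>real q2 * \<xi> i\<rfloor>))"
      using qs(3) by (simp add: frac_def of_nat_diff algebra_simps)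
    ultimately show "real (N i) * \<bar>real (q2 - q1) * \<xi> i +
        real_of_int (\<lfloor>real q1 * \<xi> i\<rfloor> - \<lfloor>real q2 * \<xi> i\<rfloor>)\<bar> \<le> 1"
      by (simp add: abs_mult)
  qed
qed

section \<open>Jump sets and the values of phi and psi\<close>

lemma span_axis_image: "span ((\<lambda>l. axis l (1::real)) ` A) = {v :: real ^ 'a::finite. \<forall>i. i \<notin> A \<longrightarrow> v $ i = 0}"
proof
  have "subspace {v :: real ^ 'a. \<forall>i. i \<notin> A \<longrightarrow> v $ i = 0}" by (simp add: subspace_def)
  then show "span ((\<lambda>l. axis l (1::real)) ` A) \<subseteq> {v :: real ^ 'a. \<forall>i. i \<notin> A \<longrightarrow> v $ i = 0}"
    by (rule span_minimal[rotated]) (auto simp: axis_def)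
  show "{v :: real ^ 'a. \<forall>i. i \<notin> A \<longrightarrow> v $ i = 0} \<subseteq> span ((\<lambda>l. axis l (1::real)) ` A)"
  proof
    fix v :: "real ^ 'a" assume v: "v \<in> {v. \<forall>i. i \<notin> A \<longrightarrow> v $ i = 0}"
    have "v = (\<Sum>i\<in>UNIV. v $ i *\<^sub>R axis i 1)"
      using basis_expansion[of v] by (simp add: scalar_mult_eq_scaleR)
    also have "\<dots> = (\<Sum>i\<in>A. v $ i *\<^sub>R axis i 1)"
      using v by (intro sum.mono_neutral_right) auto
    also have "\<dots> \<in> span ((\<lambda>l. axis l (1::real)) ` A)"
      by (intro span_sum span_scale span_base) auto
    finally show "v \<in> span ((\<lambda>l. axis l (1::real)) ` A)" .
  qed
qed

text \<open>A jump occurs at the largest possible leading index \<open>j\<close> of a nonzero vector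
  of \<open>W\<close>: such a vector lies in the coordinate subspace from \<open>j\<close> on, and
  only 0 can remain beyond \<open>j\<close>.\<close>

lemma jumps_J_nonempty:
  fixes W :: "(real ^ 'm::{finite,linorder}) set"
  assumes w: "w \<in> W" "w \<noteq> 0"
  shows "jumps_J W \<noteq> {}"
proof -
  let ?A = "{j. \<exists>w\<in>W. w \<noteq> 0 \<and> (\<forall>i<j. w $ i = 0)}"
  define j where "j = Max ?A"
  \<comment> \<open>No index precedes the smallest one, so the vanishing condition is vacuous
    there.\<close>
  have "Min UNIV \<in> ?A" using w Min_le[of UNIV] by (auto simp: not_less[symmetric])
  then have "?A \<noteq> {}" by blast
  then have "j \<in> ?A" unfolding j_def by (intro Max_in) auto
  then obtain v where v: "v \<in> W" "v \<noteq> 0" "\<forall>i<j. v $ i = 0" by blast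
  have "dim {v} \<le> dim (W \<inter> span ((\<lambda>l. axis l 1) ` {j..}))"
    using v by (intro dim_subset) (auto simp: span_axis_image)
  then have 1: "1 \<le> dim (W \<inter> span ((\<lambda>l. axis l 1) ` {j..}))"
    using v(2) by (simp add: dim_insert)
  have "W \<inter> span ((\<lambda>l. axis l 1) ` {j<..}) \<subseteq> {0}"
  proof clarify
    fix u assume u: "u \<in> W" "u \<in> span ((\<lambda>l. axis l 1) ` {j<..})"
    show "u = 0"
    proof (rule ccontr)
      assume "u \<noteq> 0"
      then have ne: "{i. u $ i \<noteq> 0} \<noteq> {}" by (auto simp: vec_eq_iff)
      define h where "h = Min {i. u $ i \<noteq> 0}"
      \<comment> \<open>The leading index \<open>h\<close> of \<open>u\<close> would exceed
        \<open>j\<close> and still belong to \<open>?A\<close>, against maximality.\<close>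
      have "u $ h \<noteq> 0" using Min_in[OF _ ne] unfolding h_def by auto
      then have "j < h" using u(2) by (auto simp: span_axis_image)
      have "u $ i = 0" if "i < h" for i
        using that Min_le[of "{i. u $ i \<noteq> 0}" i] unfolding h_def by fastforce
      then have "h \<in> ?A" using u(1) \<open>u \<noteq> 0\<close> by blast
      then have "h \<le> j" unfolding j_def by (intro Max_ge) auto
      then show False using \<open>j < h\<close> by simp
    qed
  qed
  then have "dim (W \<inter> span ((\<lambda>l. axis l 1) ` {j<..})) = 0"
    by (simp add: dim_eq_0)
  then have "j \<in> jumps_J W" using 1 unfolding jumps_J_def mem_Collect_eq by linarith
  then show ?thesis by blast
qed

lemma phi_pos:
  assumes "weight_vector \<omega>" "w \<in> W" "w \<noteq> 0"
  shows "0 < phi \<omega> W"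
  using assms jumps_J_nonempty[of w W] unfolding phi_def weight_vector_def
  by (intro sum_pos) auto

lemma psi_zero:
  fixes \<omega> :: "real ^ ('m::{finite,linorder} + 'n::{finite,linorder})"
  shows "psi \<omega> {0} = 0"
proof -
  have "{0} \<inter> span X = {0}" for X :: "(real ^ ('m + 'n)) set"
    using span_zero by blast
  then have "jumps_I {0 :: real ^ ('m + 'n)} = {}" unfolding jumps_I_def by (simp only:) simp
  then show ?thesis by (simp add: psi_def)
qed

subsection \<open>Pencils and connectedness\<close>

lemma top_rows_columnvector_nth:
  "(top_rows (columnvector \<xi>) *v w) $ i = w $ Inl i + \<xi> $ i * w $ Inr (1::1)"
  by (simp add: top_rows_nth columnvector_def)

text \<open>The kernel of the first rows is the line through \<open>(-\<xi>, 1)\<close>, which the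
  rational span avoids.\<close>

lemma top_rows_inj_on_rational_span:
  fixes \<xi> :: "real ^ 'm::finite" and v :: "real ^ ('m + 1)"
  assumes "finite B" "\<And>b i. b \<in> B \<Longrightarrow> b $ i \<in> \<rat>" "card B \<le> card S" "rat_independent_with_1 \<xi> S"
    and "v \<in> span B" "top_rows (columnvector \<xi>) *v v = 0"
  shows "v = 0"
proof -
  have "v $ Inl i = - \<xi> $ i * v $ Inr 1" for i
    using arg_cong[OF assms(6), of "\<lambda>u. u $ i"] by (simp add: top_rows_columnvector_nth)
  then show ?thesis using assms by (intro span_rational_avoids[of B S \<xi> v])
qed

text \<open>Dirichlet's principle with about \<open>exp (\<omega> $ Inl i * t)\<close> cells in
  coordinate \<open>i\<close>. The expanding weights sum to 1, so the denominator is at most a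
  constant times \<open>exp t\<close>, which the single contracting direction cancels; the bound is
  therefore uniform in \<open>t\<close>.\<close>

lemma flow_short_vector:
  fixes \<omega> :: "real ^ ('m::{finite,linorder} + 1)"
  assumes \<omega>: "weight_vector \<omega>" and t: "0 \<le> t"
  obtains w where "w \<in> int_vectors" "w \<noteq> 0" "infnorm (flow \<omega> (columnvector \<xi>) t w) \<le> 2 ^ CARD('m)"
proof -
  define N where "N i = nat \<lceil>exp (\<omega> $ Inl i * t)\<rceil>" for i
  have \<omega>pos: "0 < \<omega> $ Inl i" for i using \<omega> by (simp add: weight_vector_def)
  have \<omega>sum: "(\<Sum>i\<in>UNIV. \<omega> $ Inl i) = 1" using \<omega> by (simp add: weight_vector_def)
  have "\<omega> $ Inr 1 = 1" using \<omega> by (simp add: weight_vector_def)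
  \<comment> \<open>With a single column, the normalization of the contracting weights fixes the
    only one.\<close>
  then have \<omega>1: "\<omega> $ Inr j = 1" for j by (metis num1_eq_iff)
  have N_ge: "exp (\<omega> $ Inl i * t) \<le> N i" for i
    unfolding N_def by (rule real_nat_ceiling_ge)
  \<comment> \<open>For \<open>0 \<le> t\<close> the exponential is at least 1, so rounding up at
    most doubles it; the product of these factors is the constant
    \<open>2 ^ CARD('m)\<close>.\<close>
  have N_le: "N i \<le> 2 * exp (\<omega> $ Inl i * t)" for i
  proof -
    have "1 \<le> exp (\<omega> $ Inl i * t)" using t less_imp_le[OF \<omega>pos[of i]] by simp
    moreover have "N i \<le> exp (\<omega> $ Inl i * t) + 1"
      unfolding N_def by (simp add: of_nat_ceiling)
    ultimately show ?thesis by linarith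
  qed
  have "0 < N i" for i
    using less_le_trans[OF exp_gt_zero N_ge[of i]] by simp
  then obtain q p where qp: "0 < q" "q \<le> (\<Prod>i\<in>UNIV. N i)"
    "\<And>i. real (N i) * \<bar>q * \<xi> $ i + real_of_int (p i)\<bar> \<le> 1"
    using simultaneous_approximation[of N "\<lambda>i. \<xi> $ i"] by blast
  define w :: "real ^ ('m + 1)" where
    "w = (\<chi> k. case k of Inl i \<Rightarrow> real_of_int (p i) | Inr _ \<Rightarrow> real q)"
  have w: "w $ Inl i = p i" "w $ Inr j = q" for i j by (simp_all add: w_def)
  show thesis
  proof (rule that)
    show "w \<in> int_vectors"
      unfolding int_vectors_def w_def by (simp split: sum.split)
    show "w \<noteq> 0" using w(2)[of 1] qp(1) by auto
    have "\<bar>flow \<omega> (columnvector \<xi>) t w $ k\<bar> \<le> 2 ^ CARD('m)" for k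
    proof (cases k)
      case (Inl i)
      have "\<bar>flow \<omega> (columnvector \<xi>) t w $ k\<bar> = exp (\<omega> $ Inl i * t) * \<bar>q * \<xi> $ i + p i\<bar>"
        by (simp add: Inl flow_nth_Inl top_rows_columnvector_nth w abs_mult add.commute mult.commute[of _ "real q"])
      also have "\<dots> \<le> N i * \<bar>q * \<xi> $ i + p i\<bar>" by (intro mult_right_mono N_ge) simp
      also have "\<dots> \<le> 1" by (rule qp(3))
      also have "(1::real) \<le> 2 ^ CARD('m)" by simp
      finally show ?thesis .
    next
      case (Inr j)
      have "real q \<le> real (\<Prod>i\<in>UNIV. N i)" using qp(2) by (simp only: of_nat_le_iff)
      also have "\<dots> = (\<Prod>i\<in>UNIV. real (N i))" by (rule of_nat_prod)
      also have "\<dots> \<le> (\<Prod>i\<in>UNIV. 2 * exp (\<omega> $ Inl i * t))"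
        by (intro prod_mono) (simp add: N_le)
      also have "\<dots> = 2 ^ CARD('m) * exp (\<Sum>i\<in>UNIV. \<omega> $ Inl i * t)"
        by (simp add: prod.distrib exp_sum)
      also have "\<dots> = 2 ^ CARD('m) * exp t"
        using \<omega>sum by (simp add: sum_distrib_right[symmetric])
      finally have "real q / exp t \<le> 2 ^ CARD('m)" by (simp add: pos_divide_le_eq)
      moreover have "\<bar>flow \<omega> (columnvector \<xi>) t w $ k\<bar> = real q / exp t"
        using Inr \<omega>1 by (simp add: flow_nth_Inr w abs_mult exp_minus divide_inverse mult.commute)
      ultimately show ?thesis by simp
    qed
    then show "infnorm (flow \<omega> (columnvector \<xi>) t w) \<le> 2 ^ CARD('m)"
      by (simp add: infnorm_le_iff)
  qed
qed

lemma not_in_weakly_constraining_pencil: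
  fixes \<omega> :: "real ^ ('m::{finite,linorder} + 1)"
  assumes "weight_vector \<omega>" and "1 \<le> card S" and ind: "rat_independent_with_1 \<xi> S"
  shows "\<not> in_proper_rational_weakly_constraining_pencil \<omega> (card S) {columnvector \<xi>}"
proof
  let ?x = "columnvector \<xi> :: real ^ 1 ^ 'm::{finite,linorder}"
  assume "in_proper_rational_weakly_constraining_pencil \<omega> (card S) {?x}"
  then obtain W a b where W: "subspace W" "dim W = card S" "rational_subspace W" "b \<le> a"
    "?x \<in> pencil \<omega> W a b"
    unfolding in_proper_rational_weakly_constraining_pencil_def by blast
  obtain B where B: "independent B" "span B = W" "\<And>b i. b \<in> B \<Longrightarrow> b $ i \<in> \<rat>"
    using W(3) unfolding rational_subspace_def by blast
  have "card B = card S" using B(1,2) W(2) dim_span_eq_card_independent by metis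
  then have inj: "v = 0" if "v \<in> W" "top_rows ?x *v v = 0" for v
    using top_rows_inj_on_rational_span[OF _ B(3) _ ind] independent_imp_finite[OF B(1)] B(2) that
    by simp
  \<comment> \<open>The kernel part is trivial, so \<open>a \<le> 0\<close>; the image contains a
    nonzero vector because \<open>W\<close> does. Then
    \<open>0 < phi \<le> b \<le> a \<le> 0\<close> is absurd.\<close>
  have "{v. top_rows ?x *v v = 0} \<inter> W = {0}"
    using inj subspace_0[OF W(1)] by auto
  then have "a \<le> 0" using W(5) psi_zero[of \<omega>] by (simp add: pencil_def)
  moreover have "phi \<omega> ((*v) (top_rows ?x) ` W) \<le> b" using W(5) by (simp add: pencil_def)
  moreover obtain v where v: "v \<in> B" using \<open>card B = card S\<close> assms(2) by fastforce
  then have "v \<in> W" "v \<noteq> 0" using B(1,2) span_base dependent_zero by blast+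
  then have "0 < phi \<omega> ((*v) (top_rows ?x) ` W)"
    using inj by (intro phi_pos[OF assms(1), of "top_rows ?x *v v"]) auto
  ultimately show False using W(4) by linarith
qed

lemma connected_at_if_rat_independent:
  fixes \<omega> :: "real ^ ('m::{finite,linorder} + 1)"
  assumes \<omega>: "weight_vector \<omega>" and S: "1 \<le> card S" and ind: "rat_independent_with_1 \<xi> S"
  shows "connected_at \<omega> (lattice_of (columnvector \<xi>)) (card S)"
proof (rule ccontr)
  let ?x = "columnvector \<xi> :: real ^ 1 ^ 'm::{finite,linorder}" and ?k = "card S"
  let ?sm = "\<lambda>i t. succ_min i (flow \<omega> ?x t ` int_vectors)"
  assume "\<not> connected_at \<omega> (lattice_of ?x) ?k"
  then obtain T' where "\<forall>t\<in>{t. 0 \<le> t \<and> ln (?sm ?k t) = ln (?sm (?k + 1) t)}. t \<le> T'"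
    unfolding connected_at_def bdd_above_def log_min_lattice_of by blast
  then have T': "t \<le> T'" if "0 \<le> t" "?sm ?k t = ?sm (?k + 1) t" for t
    using that by simp
  \<comment> \<open>The maximum with 0 makes every time beyond \<open>T\<close> nonnegative, as the
    definition of connectedness and the flow estimates require.\<close>
  define T where "T = max 0 T'"
  have "card S \<le> CARD('m)" by (intro card_mono) auto
  then have k: "?k < CARD('m + 1)" "?k + 1 \<le> CARD('m + 1)" by simp_all
  have gap: "?sm ?k t < ?sm (?k + 1) t" if "T < t" for t
  proof -
    have "?sm ?k t \<le> ?sm (?k + 1) t"
      by (rule succ_min_mono[OF linear_flow inj_flow S _ k(2)]) simp
    moreover have "?sm ?k t \<noteq> ?sm (?k + 1) t" using T'[of t] that by (auto simp: T_def)
    ultimately show ?thesis by simp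
  qed
  \<comment> \<open>The time \<open>T + 1\<close> is just a reference point beyond \<open>T\<close>;
    the subspace is the same at all such times.\<close>
  define W where "W = low_span (flow \<omega> ?x (T + 1)) ?k"
  have W: "low_span (flow \<omega> ?x t) ?k = W" if "T < t" for t
    unfolding W_def using low_span_flow_constant[OF S k(1) gap that, of "T + 1"] by simp
  obtain B where B: "B \<subseteq> int_vectors" "independent B" "card B = ?k"
    "\<And>w. w \<in> B \<Longrightarrow> 2 * infnorm (flow \<omega> ?x (T + 1) w) \<le> ?sm ?k (T + 1)"
    using succ_min_attained[OF linear_flow inj_flow S less_imp_le[OF k(1)]] by blast
  have WB: "W = span B"
    unfolding W_def using B gap[of "T + 1"]
    by (intro low_span_eq[OF linear_flow inj_flow k(1)]) force+
  have rat: "b $ i \<in> \<rat>" if "b \<in> B" for b i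
    using B(1) that Ints_subset_Rats unfolding int_vectors_def by blast
  have inj: "v = 0" if "v \<in> W" "top_rows ?x *v v = 0" for v
    using top_rows_inj_on_rational_span[OF independent_imp_finite[OF B(2)] rat _ ind] B(3) WB that
    by simp
  \<comment> \<open>The slowest expansion rate.\<close>
  define \<delta> where "\<delta> = Min (range (\<lambda>i. \<omega> $ Inl i))"
  have \<delta>: "0 < \<delta>" "\<And>i. \<delta> \<le> \<omega> $ Inl i"
    using \<omega> by (simp_all add: \<delta>_def weight_vector_def)
  obtain c where c: "0 < c"
    "\<And>w t. w \<in> W \<Longrightarrow> 0 \<le> t \<Longrightarrow> c * exp (\<delta> * t) * infnorm w \<le> infnorm (flow \<omega> ?x t w)"
    using infnorm_flow_ge[OF _ inj \<delta>(2)] WB subspace_span by metis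
  let ?C = "2 ^ CARD('m) :: real"
  \<comment> \<open>The Dirichlet vector is exchanged for a nonzero integer vector of
    \<open>W\<close>; its norm is at least 1 before the flow expands it.\<close>
  have bound: "c * exp (\<delta> * t) \<le> ?C" if t: "T < t" for t
  proof -
    have t0: "0 \<le> t" using t by (simp add: T_def)
    obtain w where w: "w \<in> int_vectors" "w \<noteq> 0" "infnorm (flow \<omega> ?x t w) \<le> ?C"
      using flow_short_vector[OF \<omega> t0] by blast
    obtain v where v: "v \<in> W" "v \<in> int_vectors" "v \<noteq> 0" "infnorm (flow \<omega> ?x t v) \<le> ?C"
      using low_span_short_vector[OF linear_flow inj_flow S k(1) gap[OF t] w] W[OF t] by blast
    have "c * exp (\<delta> * t) * 1 \<le> c * exp (\<delta> * t) * infnorm v"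
      using c(1) infnorm_ge_1_int_vector[OF v(2,3)] by (intro mult_left_mono) auto
    also have "\<dots> \<le> infnorm (flow \<omega> ?x t v)" using c(2)[OF v(1) t0] .
    finally show ?thesis using v(4) by simp
  qed
  \<comment> \<open>Chosen so that \<open>c * \<delta> * t\<close> exceeds \<open>?C\<close>; since
    \<open>exp (\<delta> * t)\<close> is at least \<open>\<delta> * t\<close>, the bound fails at
    this time.\<close>
  define t where "t = T + 1 + ?C / (c * \<delta>)"
  have "0 < ?C / (c * \<delta>)" using c(1) \<delta>(1) by simp
  then have t: "T < t" "?C / (c * \<delta>) < t" by (auto simp: t_def T_def)
  have "?C = c * \<delta> * (?C / (c * \<delta>))" using c(1) \<delta>(1) by simp
  also have "\<dots> < c * \<delta> * t" using t(2) c(1) \<delta>(1) by (intro mult_strict_left_mono) auto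
  also have "c * \<delta> * t \<le> c * exp (\<delta> * t)"
  proof -
    have "\<delta> * t \<le> exp (\<delta> * t)" using exp_ge_add_one_self[of "\<delta> * t"] by linarith
    then show ?thesis using c(1) by (simp add: mult.assoc)
  qed
  finally show False using bound[OF t(1)] by simp
qed

theorem corollary1p14:
  fixes d :: nat
    and \<omega> :: "real ^ ('m::{finite,linorder} + 1)"
    and \<xi> :: "real ^ 'm::{finite,linorder}"
    and x :: "real ^ 1 ^ 'm::{finite,linorder}"
  assumes "2 \<le> d"
    and "CARD('m) = d - 1"
    and "weight_vector \<omega>"
    and "x = columnvector \<xi>"
  shows "(\<forall>k\<in>{1..d - 1}. (\<exists>S::'m set. card S = k \<and> rat_independent_with_1 \<xi> S) \<longrightarrow>
            \<not> in_proper_rational_weakly_constraining_pencil \<omega> k {x} \<and>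
            connected_at \<omega> (lattice_of x) k) \<and>
         (rat_independent_with_1 \<xi> UNIV \<longrightarrow>
            (\<forall>k\<in>{1..d - 1}. connected_at \<omega> (lattice_of x) k))"
proof -
  have *: "\<not> in_proper_rational_weakly_constraining_pencil \<omega> k {x} \<and> connected_at \<omega> (lattice_of x) k"
    if "1 \<le> k" "card S = k" "rat_independent_with_1 \<xi> S" for k and S :: "'m set"
    using that not_in_weakly_constraining_pencil[OF assms(3)]
      connected_at_if_rat_independent[OF assms(3)] assms(4) by blast
  have "\<exists>S::'m set. card S = k \<and> rat_independent_with_1 \<xi> S"
    if ind: "rat_independent_with_1 \<xi> UNIV" and "k \<in> {1..d - 1}" for k
  proof -
    have "k \<le> CARD('m)" using that(2) assms(2) by simp
    then obtain S :: "'m set" where "card S = k"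
      using obtain_subset_with_card_n by blast
    moreover have "rat_independent_with_1 \<xi> S"
      unfolding rat_independent_with_1_def
    proof (intro allI impI)
      fix q0 :: rat and q :: "'m \<Rightarrow> rat"
      assume "of_rat q0 * 1 + (\<Sum>i\<in>S. of_rat (q i) * \<xi> $ i) = 0"
      \<comment> \<open>A relation over \<open>S\<close> becomes one over all indices by giving the
        remaining entries coefficient 0, so independence passes to any subset of size
        \<open>k\<close>.\<close>
      moreover have "(\<Sum>i\<in>UNIV. of_rat (if i \<in> S then q i else 0) * \<xi> $ i) =
          (\<Sum>i\<in>S. of_rat (q i) * \<xi> $ i)"
        by (intro sum.mono_neutral_cong_right) auto
      ultimately have "q0 = 0 \<and> (\<forall>i\<in>UNIV. (if i \<in> S then q i else 0) = 0)"
        using ind[unfolded rat_independent_with_1_def, rule_format,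
            of q0 "\<lambda>i. if i \<in> S then q i else 0"] by simp
      then show "q0 = 0 \<and> (\<forall>i\<in>S. q i = 0)" by (metis UNIV_I)
    qed
    ultimately show ?thesis by blast
  qed
  with * show ?thesis by (metis atLeastAtMost_iff)
qed

end
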